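(* Let the trinomial $f(x)=\alpha x^{n}-\beta x^{k}+\gamma$ with $\alpha,\beta,\gamma>0$, $n\geq 3$, and $1\leq k\leq n-1$, have two positive roots $r_1$ and $r_2$ with $r_1<r_2$. Then for $r_1\leq\bar{x}\leq r_2$, the function $$h(x)=\frac{\alpha\delta}{\epsilon - x^{k}} - \beta x^{k}+\gamma ,$$ where $$\delta=\frac{k}{n}\,\bar{x}^{\,k+n}>0, \qquad \epsilon=\frac{n+k}{n}\,\bar{x}^{\,k}>\bar{x}^{\,k},$$ has two positive zeros $s_1$ and $s_2$ with $r_1\leq s_1<s_2\leq r_2$, and $h(x)\geq f(x)$ for $0\leq x<\left(1+\frac{n}{k}\right)\bar{x}$.
   Context: Here $n$ and $k$ are integers, $\alpha,\beta,\gamma$ are real numbers, and $f$ and $h$ are functions of a real variable $x$.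
   Formalization: The inequality h(x) ≥ f(x) is stated for 0 ≤ x < (1+k/n)^{1/k} x̄, i.e. up to the pole of h, instead of 0 ≤ x < (1+n/k) x̄, because h is undefined at the pole and h < f at every point beyond it. *)

theory Defs
  imports Complex_Main
begin

end

theory Submission
  imports Defs
begin

text \<open>
  In the variable \<open>y = x ^ k\<close>, the function \<open>f\<close> is strictly convex and \<open>(\<epsilon> - y) * h\<close> is a
  quadratic polynomial \<open>Q\<close>.  The weighted AM-GM inequality, applied to \<open>x / xbar\<close>, yields both
  \<open>h \<ge> f\<close> to the left of the pole (with equality at \<open>xbar\<close>) and the strict tangent inequality for
  \<open>f\<close> at \<open>xbar\<close>.  By the latter either \<open>f xbar < 0\<close>, or \<open>xbar\<close> is one of \<open>r1\<close>, \<open>r2\<close> and \<open>f\<close>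
  has non-zero slope there; either way \<open>Q\<close> has two distinct roots enclosing \<open>xbar ^ k\<close>.  They lie
  between \<open>r1 ^ k\<close> and \<open>r2 ^ k\<close> because \<open>h \<ge> 0\<close> at \<open>r1\<close> and, if it lies before the pole, at \<open>r2\<close>.
\<close>

text \<open>Induction on the weight \<open>b\<close>: both sides agree at \<open>b = 0\<close>, and
  each unit increase of \<open>b\<close> widens the gap.\<close>

lemma weighted_am_gm_power_strict:
  fixes u :: real
  assumes "0 < u" "u \<noteq> 1" "0 < a" "0 < b"
  shows "real (a + b) * u ^ a < real a * u ^ (a + b) + real b"
proof -
  \<comment> \<open>This is the growth of right side minus left side when \<open>b\<close> goes from
    \<open>c\<close> to \<open>c + 1\<close>. It is a sum of products
    \<open>(u - 1) * (u ^ (a + c) - u ^ i)\<close>, whose factors share their sign.\<close>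
  have step: "real a * u ^ (a + c) * (u - 1) - (u ^ a - 1) > 0" for c
  proof -
    have pos: "(u - 1) * (u ^ (a + c) - u ^ i) > 0" if "i < a" for i
    proof (cases "u < 1")
      case True
      then have "u ^ (a + c) < u ^ i"
        using assms that by (intro power_strict_decreasing) auto
      with True show ?thesis by (intro mult_neg_neg) auto
    next
      case False
      then have "u ^ i < u ^ (a + c)"
        using assms that by (intro power_strict_increasing) auto
      with False assms show ?thesis by (intro mult_pos_pos) auto
    qed
    have "(\<Sum>i<a. (u - 1) * (u ^ (a + c) - u ^ i)) > 0"
      using pos assms by (intro sum_pos) auto
    also have "(\<Sum>i<a. (u - 1) * (u ^ (a + c) - u ^ i))
        = (u - 1) * (real a * u ^ (a + c)) - (u - 1) * (\<Sum>i<a. u ^ i)"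
      by (simp add: sum_distrib_left[symmetric] sum_subtractf right_diff_distrib)
    also have "(u - 1) * (\<Sum>i<a. u ^ i) = u ^ a - 1"
      by (simp add: power_diff_1_eq)
    finally show ?thesis by (simp add: mult_ac)
  qed
  have "real (a + Suc c) * u ^ a < real a * u ^ (a + Suc c) + real (Suc c)" for c
  proof (induction c)
    case 0
    then show ?case using step[of 0] by (simp add: algebra_simps)
  next
    case (Suc c)
    then show ?case using step[of "Suc c"] by (simp add: algebra_simps)
  qed
  from this[of "b - 1"] show ?thesis using assms by simp
qed

lemma weighted_am_gm_power:
  fixes u :: real
  assumes "0 \<le> u" "0 < a" "0 < b"
  shows "real (a + b) * u ^ a \<le> real a * u ^ (a + b) + real b"
  using weighted_am_gm_power_strict[of u a b] assms
  by (cases "u = 0 \<or> u = 1") (auto simp: power_0_left)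

lemma quadratic_distinct_roots:
  fixes a b c :: real
  assumes "a > 0" "b\<^sup>2 - 4 * a * c > 0"
  obtains t1 t2 where "t1 < t2" "\<And>y. a * y\<^sup>2 + b * y + c = a * (y - t1) * (y - t2)"
proof -
  define s where "s = sqrt (b\<^sup>2 - 4 * a * c)"
  have s: "s > 0" "s\<^sup>2 = b\<^sup>2 - 4 * a * c" using assms by (auto simp: s_def)
  then have c: "c = (b\<^sup>2 - s\<^sup>2) / (4 * a)" using assms by (simp add: field_simps)
  show thesis
  proof (rule that[of "(- b - s) / (2 * a)" "(- b + s) / (2 * a)"])
    show "(- b - s) / (2 * a) < (- b + s) / (2 * a)"
      using s assms by (intro divide_strict_right_mono) auto
    show "a * y\<^sup>2 + b * y + c = a * (y - (- b - s) / (2 * a)) * (y - (- b + s) / (2 * a))" for y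
      using assms unfolding c by (simp add: field_simps power2_eq_square)
  qed
qed

theorem theorem3p2:
  fixes \<alpha> \<beta> \<gamma> \<delta> \<epsilon> r1 r2 xbar :: real
    and n k :: nat
    and f h :: "real \<Rightarrow> real"
  assumes "\<alpha> > 0" and "\<beta> > 0" and "\<gamma> > 0"
    and "n \<ge> 3" and "1 \<le> k" and "k \<le> n - 1"
    and "f = (\<lambda>x. \<alpha> * x ^ n - \<beta> * x ^ k + \<gamma>)"
    and "0 < r1" and "r1 < r2" and "f r1 = 0" and "f r2 = 0"
    and "r1 \<le> xbar" and "xbar \<le> r2"
    and "\<delta> = real k / real n * xbar ^ (k + n)"
    and "\<epsilon> = (real n + real k) / real n * xbar ^ k"
    and "h = (\<lambda>x. \<alpha> * \<delta> / (\<epsilon> - x ^ k) - \<beta> * x ^ k + \<gamma>)"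
  shows "\<delta> > 0 \<and> \<epsilon> > xbar ^ k
    \<and> (\<exists>s1 s2. r1 \<le> s1 \<and> s1 < s2 \<and> s2 \<le> r2
          \<and> {x. 0 < x \<and> x ^ k \<noteq> \<epsilon> \<and> h x = 0} = {s1, s2})
    \<and> (\<forall>x. 0 \<le> x \<and> x < root k (1 + real k / real n) * xbar \<longrightarrow> f x \<le> h x)"
proof -
  have nk: "0 < k" "k < n" using assms by auto
  have xb: "xbar > 0" using assms by simp
  define Y where "Y = xbar ^ k"
  have Y: "Y > 0" using xb by (simp add: Y_def)
  have X: "xbar ^ n > 0" using xb by simp
  have \<delta>: "\<delta> = real k / real n * xbar ^ n * Y"
    using assms by (simp add: Y_def power_add)
  have \<epsilon>: "\<epsilon> = (1 + real k / real n) * Y"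
    using assms nk by (simp add: Y_def field_simps)
  have \<delta>pos: "\<delta> > 0" unfolding \<delta> using nk Y X by simp
  have \<epsilon>Y: "\<epsilon> > Y" unfolding \<epsilon> using nk Y by (simp add: field_simps)
  note f = assms(7) and h = assms(16)

  \<comment> \<open>\<open>\<delta>\<close> is the maximum of
    \<open>x ^ n * (\<epsilon> - x ^ k)\<close> over \<open>x \<ge> 0\<close>, attained at
    \<open>xbar\<close>; dividing by the positive factor \<open>\<epsilon> - x ^ k\<close> gives the
    bound.\<close>
  have fh: "f x \<le> h x" if x: "0 \<le> x" "x ^ k < \<epsilon>" for x
  proof -
    define u where "u = x / xbar"
    have u: "u \<ge> 0" "x = u * xbar" using x xb by (auto simp: u_def)
    have "real (n + k) * u ^ n \<le> real n * u ^ (n + k) + real k"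
      using weighted_am_gm_power[of u n k] u nk by simp
    moreover have "real n * (u ^ n * (1 + real k / real n - u ^ k)) = real (n + k) * u ^ n - real n * u ^ (n + k)"
      using nk by (simp add: field_simps power_add)
    ultimately have "u ^ n * (1 + real k / real n - u ^ k) \<le> real k / real n"
      using nk by (simp add: pos_le_divide_eq mult.commute)
    then have "xbar ^ n * Y * (u ^ n * (1 + real k / real n - u ^ k)) \<le> xbar ^ n * Y * (real k / real n)"
      using X Y by (intro mult_left_mono) auto
    then have "x ^ n * (\<epsilon> - x ^ k) \<le> \<delta>"
      unfolding \<delta> \<epsilon> u(2) Y_def power_mult_distrib by (simp add: algebra_simps)
    then have "\<alpha> * (x ^ n * (\<epsilon> - x ^ k)) \<le> \<alpha> * \<delta>"
      using assms(1) by (intro mult_left_mono) auto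
    then have "\<alpha> * x ^ n \<le> \<alpha> * \<delta> / (\<epsilon> - x ^ k)"
      using x by (simp add: pos_le_divide_eq mult.assoc)
    then show ?thesis unfolding f h by simp
  qed

  \<comment> \<open>The derivative of \<open>f\<close> at \<open>xbar\<close> with respect to the
    scaled variable \<open>x ^ k / Y\<close>.\<close>
  define B where "B = real n / real k * \<alpha> * xbar ^ n - \<beta> * Y"
  have tangent: "f xbar + B * (x ^ k / Y - 1) < f x" if x: "0 < x" "x \<noteq> xbar" for x
  proof -
    define u where "u = x / xbar"
    have u: "u > 0" "u \<noteq> 1" "x = u * xbar" using x xb by (auto simp: u_def)
    have "real n * u ^ k < real k * u ^ n + real (n - k)"
      using weighted_am_gm_power_strict[of u k "n - k"] u nk by simp
    then have "1 + real n / real k * (u ^ k - 1) < u ^ n"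
      using nk by (simp add: field_simps of_nat_diff)
    then have "\<alpha> * xbar ^ n * (1 + real n / real k * (u ^ k - 1)) < \<alpha> * xbar ^ n * u ^ n"
      using X assms(1) by (intro mult_strict_left_mono) auto
    moreover have "x ^ k / Y = u ^ k"
      using xb by (simp add: u(3) Y_def power_mult_distrib)
    ultimately show ?thesis
      unfolding f B_def by (simp add: u(3) Y_def power_mult_distrib algebra_simps)
  qed

  have Y12: "r1 ^ k \<le> Y" "Y \<le> r2 ^ k"
    unfolding Y_def using assms by (auto intro!: power_mono)
  have tangent1: "f xbar + B * (r1 ^ k / Y - 1) < 0" if "xbar \<noteq> r1"
    using tangent[of r1] that assms(8,10) by simp
  have tangent2: "f xbar + B * (r2 ^ k / Y - 1) < 0" if "xbar \<noteq> r2"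
    using tangent[of r2] that assms(8,9,11) by simp
  \<comment> \<open>Otherwise the tangent would be nonnegative at \<open>r2\<close>, while it lies
    strictly below \<open>f r2 = 0\<close>. If \<open>xbar\<close> were strictly between the roots,
    \<open>slope1\<close> and \<open>slope2\<close> would clash.\<close>
  have slope1: "B < 0" if "f xbar \<ge> 0" "xbar \<noteq> r2"
  proof (rule ccontr)
    assume "\<not> B < 0"
    then have "B * (r2 ^ k / Y - 1) \<ge> 0" using Y12 Y by (intro mult_nonneg_nonneg) auto
    with tangent2 that show False by simp
  qed
  have slope2: "B > 0" if "f xbar \<ge> 0" "xbar \<noteq> r1"
  proof (rule ccontr)
    assume "\<not> B > 0"
    then have "B * (r1 ^ k / Y - 1) \<ge> 0" using Y12 Y by (intro mult_nonpos_nonpos) auto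
    with tangent1 that show False by simp
  qed
  have fxbar: "f xbar < 0 \<or> xbar = r1 \<and> f xbar = 0 \<and> B < 0 \<or> xbar = r2 \<and> f xbar = 0 \<and> B > 0"
  proof (cases "f xbar < 0")
    case False
    then have "xbar = r1 \<or> xbar = r2" using slope1 slope2 by force
    then show ?thesis using False slope1 slope2 assms(9-11) by auto
  qed simp

  \<comment> \<open>Coefficients of \<open>\<alpha> * \<delta> + (\<epsilon> - y) * (\<gamma> -
    \<beta> * y)\<close>.\<close>
  define b c where "b = - (\<gamma> + \<beta> * \<epsilon>)" and "c = \<alpha> * \<delta> + \<gamma> * \<epsilon>"
  define Q where "Q = (\<lambda>y. \<beta> * y\<^sup>2 + b * y + c)"
  have Qh: "Q (x ^ k) = (\<epsilon> - x ^ k) * h x" if "x ^ k \<noteq> \<epsilon>" for x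
    using that unfolding Q_def b_def c_def h by (simp add: field_simps power2_eq_square)
  have Q\<epsilon>: "Q \<epsilon> > 0"
    unfolding Q_def b_def c_def using \<delta>pos assms(1) by (simp add: algebra_simps power2_eq_square)
  have QY: "Q Y = real k / real n * Y * f xbar"
    unfolding Q_def b_def c_def f \<delta> \<epsilon> Y_def[symmetric]
    by (simp add: algebra_simps power2_eq_square add_divide_distrib)
  \<comment> \<open>The left side is the derivative of \<open>Q\<close> at \<open>Y\<close>. It is a
    multiple of \<open>B\<close> because \<open>h\<close> touches \<open>f\<close> at
    \<open>xbar\<close>, so both have the same slope there.\<close>
  have dQY: "2 * \<beta> * Y + b = real k / real n * B" if "f xbar = 0"
  proof -
    have \<gamma>: "\<gamma> = \<beta> * Y - \<alpha> * xbar ^ n" using that unfolding f Y_def by simp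
    show ?thesis unfolding b_def \<epsilon> B_def \<gamma> using nk by (simp add: field_simps)
  qed
  \<comment> \<open>The discriminant is unchanged by expanding \<open>Q\<close> around
    \<open>Y\<close>, where value and slope are known.\<close>
  have "b\<^sup>2 - 4 * \<beta> * c = (2 * \<beta> * Y + b)\<^sup>2 - 4 * \<beta> * Q Y"
    unfolding Q_def by (simp add: algebra_simps power2_eq_square)
  also have "\<dots> > 0"
  proof (cases "f xbar < 0")
    case True
    then have "Q Y < 0" unfolding QY using nk Y by (intro mult_pos_neg) auto
    then have "\<beta> * Q Y < 0" using assms(2) by (intro mult_pos_neg)
    then show ?thesis using zero_le_power2[of "2 * \<beta> * Y + b"] by linarith
  next
    case False
    with fxbar have "f xbar = 0" "B \<noteq> 0" by auto
    with dQY nk show ?thesis by (simp add: QY)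
  qed
  finally obtain t1 t2 where t: "t1 < t2" and Qt: "\<And>y. Q y = \<beta> * (y - t1) * (y - t2)"
    unfolding Q_def using quadratic_distinct_roots assms(2) by blast

  have neg_iff: "Q y < 0 \<longleftrightarrow> t1 < y \<and> y < t2" for y
    unfolding Qt using t assms(2) by (auto simp: mult_less_0_iff zero_less_mult_iff)
  have zero_iff: "Q y = 0 \<longleftrightarrow> y = t1 \<or> y = t2" for y
    unfolding Qt using assms(2) by auto
  have "2 * \<beta> * Y + b = \<beta> * (2 * Y - t1 - t2)"
  proof -
    have "b = - \<beta> * (t1 + t2)"
      using Qt[of 1] Qt[of "-1"] unfolding Q_def by (simp add: algebra_simps)
    then show ?thesis by (simp add: algebra_simps)
  qed
  with dQY have dY: "real k / real n * B = \<beta> * (2 * Y - t1 - t2)" if "f xbar = 0"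
    using that by simp
  \<comment> \<open>When \<open>Q Y = 0\<close>, the sign of the slope at \<open>Y\<close> decides
    which of the two roots \<open>Y\<close> is.\<close>
  have enclose: "t1 < Y \<and> Y < t2 \<or> xbar = r1 \<and> Y = t1 \<or> xbar = r2 \<and> Y = t2"
    using fxbar
  proof (elim disjE conjE)
    assume "f xbar < 0"
    then have "Q Y < 0" unfolding QY using nk Y by (intro mult_pos_neg) auto
    then show ?thesis by (simp add: neg_iff)
  next
    assume *: "xbar = r1" "f xbar = 0" "B < 0"
    then have "\<beta> * (2 * Y - t1 - t2) < 0"
      unfolding dY[OF *(2), symmetric] using nk by (intro mult_pos_neg) auto
    then have "2 * Y - t1 - t2 < 0" using assms(2) by (simp add: mult_less_0_iff)
    moreover have "Y = t1 \<or> Y = t2" using * QY zero_iff by simp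
    ultimately show ?thesis using t * by auto
  next
    assume *: "xbar = r2" "f xbar = 0" "B > 0"
    then have "\<beta> * (2 * Y - t1 - t2) > 0"
      unfolding dY[OF *(2), symmetric] using nk by (intro mult_pos_pos) auto
    then have "2 * Y - t1 - t2 > 0" using assms(2) by (simp add: zero_less_mult_iff)
    moreover have "Y = t1 \<or> Y = t2" using * QY zero_iff by simp
    ultimately show ?thesis using t * by auto
  qed
  have Q_nonneg: "Q (x ^ k) \<ge> 0" if "0 < x" "f x = 0" "x ^ k < \<epsilon>" for x
    using fh[of x] that Qh[of x] by simp
  \<comment> \<open>\<open>Q\<close> is positive at \<open>\<epsilon>\<close>, which exceeds
    \<open>Y \<ge> t1\<close> and hence must lie beyond both roots.\<close>
  have t2\<epsilon>: "t2 < \<epsilon>"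
    using Q\<epsilon> neg_iff[of \<epsilon>] zero_iff[of \<epsilon>] enclose \<epsilon>Y by auto
  have t1_ge: "r1 ^ k \<le> t1"
  proof -
    have "Q (r1 ^ k) \<ge> 0" using Q_nonneg[of r1] assms(8,10) Y12 \<epsilon>Y by simp
    \<comment> \<open>Strictness rules out \<open>r1 ^ k = t2\<close> in the boundary case
      \<open>Y = t2\<close>.\<close>
    moreover have "r1 ^ k < Y" if "xbar = r2"
      using that assms(8,9) nk by (simp add: Y_def power_strict_mono)
    ultimately show ?thesis using neg_iff[of "r1 ^ k"] enclose Y12 t by (auto simp: Y_def)
  qed
  have t2_le: "t2 \<le> r2 ^ k"
  proof (cases "r2 ^ k < \<epsilon>")
    case True
    then have "Q (r2 ^ k) \<ge> 0" using Q_nonneg[of r2] assms(8,9,11) by simp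
    moreover have "Y < r2 ^ k" if "xbar = r1"
      using that assms(8,9) nk by (simp add: Y_def power_strict_mono)
    ultimately show ?thesis using neg_iff[of "r2 ^ k"] enclose Y12 t by (auto simp: Y_def)
  next
    case False
    then show ?thesis using t2\<epsilon> by simp
  qed

  define s1 s2 where "s1 = root k t1" and "s2 = root k t2"
  have tpos: "0 < t1" "0 < t2"
    using t1_ge t assms(8) zero_less_power[of r1 k] by linarith+
  have s: "0 < s1" "0 < s2" "s1 ^ k = t1" "s2 ^ k = t2" "s1 < s2"
    using tpos nk t by (simp_all add: s1_def s2_def real_root_gt_zero real_root_less_mono)
  have s_root: "x = s1 \<longleftrightarrow> x ^ k = t1" "x = s2 \<longleftrightarrow> x ^ k = t2" if "0 < x" for x
    using that s nk power_eq_iff_eq_base[of k x] by (metis less_imp_le)+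
  have "r1 \<le> s1"
    using t1_ge s nk assms(8) by (metis less_imp_le power_mono_iff)
  moreover have "s2 \<le> r2"
    using t2_le s nk assms(8,9) by (metis less_imp_le less_trans power_mono_iff)
  moreover have "{x. 0 < x \<and> x ^ k \<noteq> \<epsilon> \<and> h x = 0} = {s1, s2}"
  proof -
    have "0 < x \<and> x ^ k \<noteq> \<epsilon> \<and> h x = 0 \<longleftrightarrow> x = s1 \<or> x = s2" for x
    proof
      assume "0 < x \<and> x ^ k \<noteq> \<epsilon> \<and> h x = 0"
      then show "x = s1 \<or> x = s2" using Qh[of x] zero_iff s_root by auto
    next
      assume "x = s1 \<or> x = s2"
      then have "0 < x" "x ^ k \<noteq> \<epsilon>" "Q (x ^ k) = 0"
        using s t t2\<epsilon> zero_iff by auto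
      then show "0 < x \<and> x ^ k \<noteq> \<epsilon> \<and> h x = 0" using Qh[of x] by simp
    qed
    then show ?thesis by auto
  qed
  \<comment> \<open>The upper bound on \<open>x\<close> is exactly the positive pole of
    \<open>h\<close>.\<close>
  moreover have "f x \<le> h x" if "0 \<le> x" "x < root k (1 + real k / real n) * xbar" for x
  proof (rule fh)
    have "x ^ k < (root k (1 + real k / real n) * xbar) ^ k"
      using that nk by (intro power_strict_mono) auto
    also have "\<dots> = \<epsilon>"
      using nk by (simp add: \<epsilon> Y_def power_mult_distrib)
    finally show "x ^ k < \<epsilon>" .
  qed (use that in simp)
  ultimately show ?thesis using \<delta>pos \<epsilon>Y s(5) unfolding Y_def by blast
qed

end
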